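(* Let $\mathbb{K}$ be $\mathbb{R}$ or $\mathbb{C}$. The set $\mathrm{IMPS}(2,4,3)\subset(\mathbb{K}^4)^{\otimes 3}$ is not closed. In fact, there exists a curve $c:(0,1]\to \mathrm{IMPS}(2,4,3)$ for which the limit $\lim_{t\to 0}c(t)$ (exists in $(\mathbb{K}^4)^{\otimes 3}$ and) does not even belong to $\mathrm{MPS}((2,2,2),(4,4,4),3)$.
   Context: Limits and closedness are with respect to the Euclidean topology on finite-dimensional $\mathbb{K}$-vector spaces. For a tensor $T\in\mathbb{K}^{b_1}\otimes\dots\otimes\mathbb{K}^{b_q}$ write $T[i_1,\dots,i_q]$ for its coordinates in the standard basis. Site-independent (cyclic) matrix product states: for integers $r>0$, $k>0$, $q>1$, the set $\mathrm{IMPS}(r,k,q)\subset(\mathbb{K}^k)^{\otimes q}$ consists of all tensors $T$ for which there exist matrices $M_1,\dots,M_k\in\mathbb{K}^{r\times r}$ such that $T[i_1,\dots,i_q]=\operatorname{tr}(M_{i_1}M_{i_2}\cdots M_{i_q})$ for all $1\le i_1,\dots,i_q\le k$. Cyclic matrix product states: for an integer $q>1$ and tuples of positive integers $\mathfrak{a}=(a_1,\dots,a_q)$, $\mathfrak{b}=(b_1,\dots,b_q)$, with $a_{q+1}:=a_1$, the set $\mathrm{MPS}(\mathfrak{a},\mathfrak{b},q)\subset\mathbb{K}^{b_1}\otimes\dots\otimes\mathbb{K}^{b_q}$ consists of all tensors $T$ for which there exist matrices $M_{i,j}\in\mathbb{K}^{a_j\times a_{j+1}}$ ($j=1,\dots,q$,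 $i=1,\dots,b_j$) such that $T[i_1,\dots,i_q]=\operatorname{tr}(M_{i_1,1}M_{i_2,2}\cdots M_{i_q,q})$ for all indices $1\le i_j\le b_j$. *)

theory Defs
  imports "HOL-Analysis.Function_Topology" "Jordan_Normal_Form.Matrix"
begin

text \<open>
  A tensor of format $b = (b_1, \dots, b_q)$ is given by its coordinates in the standard basis:
  it is a function on the multi-indices of that format, extended by \<open>undefined\<close> outside of them.
  Positions and index values are counted from 0, so the entry usually written $b_{j+1}$ is \<open>b ! j\<close>
  and the indices in that position are $0, \dots, b_{j+1} - 1$.
\<close>

definition multi_indices :: "nat list \<Rightarrow> nat list set" where
  "multi_indices b = {is. list_all2 (<) is b}"

definition tensor_space :: "nat list \<Rightarrow> (nat list \<Rightarrow> 'a) set" where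
  "tensor_space b = multi_indices b \<rightarrow>\<^sub>E UNIV"

text \<open>
  The Euclidean topology on a finite-dimensional coordinate space: the product topology over the
  finitely many coordinates. Its underlying set is \<^term>\<open>tensor_space b\<close>.
\<close>

definition tensor_topology :: "nat list \<Rightarrow> (nat list \<Rightarrow> 'a::topological_space) topology" where
  "tensor_topology b = product_topology (\<lambda>_. euclidean) (multi_indices b)"

lemma topspace_tensor_topology [simp]: "topspace (tensor_topology b) = tensor_space b"
  by (simp add: tensor_topology_def tensor_space_def)

definition mat_trace :: "'a::comm_monoid_add mat \<Rightarrow> 'a" where
  "mat_trace A = (\<Sum>i<dim_row A. A $$ (i, i))"

text \<open>
  The product of a list of (possibly rectangular) matrices of composable sizes; \<open>n\<close> is the number
  of columns of the last one.
\<close>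

definition mat_list_prod :: "nat \<Rightarrow> 'a::semiring_1 mat list \<Rightarrow> 'a mat" where
  "mat_list_prod n As = foldr (*) As (1\<^sub>m n)"

definition IMPS :: "nat \<Rightarrow> nat \<Rightarrow> nat \<Rightarrow> (nat list \<Rightarrow> 'a::comm_ring_1) set" where
  "IMPS r k q = {T \<in> tensor_space (replicate q k).
     \<exists>M :: nat \<Rightarrow> 'a mat.
       (\<forall>i<k. M i \<in> carrier_mat r r) \<and>
       (\<forall>is\<in>multi_indices (replicate q k). T is = mat_trace (mat_list_prod r (map M is)))}"

text \<open>
  To be used with \<open>length a = length b = q\<close>. The matrix \<open>M i j\<close> is the one for index value \<open>i\<close> in
  position \<open>j\<close>; the cyclic convention $a_{q+1} = a_1$ is the \<open>mod\<close>.
\<close>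

definition MPS :: "nat list \<Rightarrow> nat list \<Rightarrow> nat \<Rightarrow> (nat list \<Rightarrow> 'a::comm_ring_1) set" where
  "MPS a b q = {T \<in> tensor_space b.
     \<exists>M :: nat \<Rightarrow> nat \<Rightarrow> 'a mat.
       (\<forall>j<q. \<forall>i<b ! j. M i j \<in> carrier_mat (a ! j) (a ! (Suc j mod q))) \<and>
       (\<forall>is\<in>multi_indices b.
          T is = mat_trace (mat_list_prod (a ! 0) (map (\<lambda>j. M (is ! j) j) [0..<q])))}"

end

theory Submission
  imports Defs "Jordan_Normal_Form.Determinant"
begin

text \<open>
  Give the matrix units $E_{11}, E_{12}, E_{21}, E_{22}$ the weights $t, t^{-1}, 1, t$. In
  $\operatorname{tr}(XYZ)$ the terms built from $E_{12}$, $E_{21}$ and one diagonal unit have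
  weight $1$, while $E_{11}^3$ and $E_{22}^3$ have weight $t^3$ and disappear as $t \to 0$. Each
  flattening of the limit $L$ is injective, so if $L[i,j,k] = \operatorname{tr}(A_i B_j C_k)$ then
  the $B_j$ and the $C_k$ are bases of the space of $2 \times 2$ matrices. Hence the slice
  $L[0,\cdot,\cdot]$ has the rank of $(Y, Z) \mapsto \operatorname{tr}(A_0 Y Z)$, which is even; but
  that slice has a single nonzero entry.
\<close>

text \<open>The index \<open>2 * p + q\<close> stands for the matrix unit with its 1 in row
  \<open>p\<close> and column \<open>q\<close>, counted from 0. The triples are the cyclic rotations
  of the products E11 E12 E21 and E22 E21 E12.\<close>

definition limit_support :: "nat list set" where
  "limit_support = {[0,1,2], [1,2,0], [2,0,1], [3,2,1], [2,1,3], [1,3,2]}"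

text \<open>The traces are entered as polynomials in \<open>t\<close>, so that the curve extends
  continuously to \<open>t = 0\<close>, where the weight of E12 blows up.\<close>

definition tensor_curve :: "real \<Rightarrow> nat list \<Rightarrow> 'a::real_normed_field" where
  "tensor_curve t = (\<lambda>is\<in>multi_indices [4,4,4].
     of_bool (is \<in> limit_support) + of_real t ^ 3 * of_bool (is \<in> {[0,0,0], [3,3,3]}))"

definition limit_tensor :: "nat list \<Rightarrow> 'a::real_normed_field" where
  "limit_tensor = (\<lambda>is\<in>multi_indices [4,4,4]. of_bool (is \<in> limit_support))"

lemma tensor_curve_0: "tensor_curve 0 = limit_tensor"
  by (simp add: tensor_curve_def limit_tensor_def)

section \<open>Multi-indices, finite sums and the trace of three factors\<close>

lemma multi_indices_444:
  "multi_indices [4,4,4] = {[i,j,k] | i j k. i < 4 \<and> j < 4 \<and> k < 4}"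
  by (auto simp: multi_indices_def list_all2_Cons2)

lemma sum_lessThan_2: "(\<Sum>p<2. f p) = f 0 + f (1::nat)"
  by (simp add: numeral_2_eq_2)

lemma sum_lessThan_4: "(\<Sum>p<4. f p) = f 0 + f 1 + f 2 + f (3::nat)"
  by (simp add: eval_nat_numeral)

text \<open>The inner sum is kept as an entry of \<open>A * B\<close>, since this product later
  serves as the coefficient matrix of a functional on the third factor.\<close>

lemma mat_trace_prod3:
  fixes A B C :: "'a::comm_semiring_1 mat"
  assumes "A \<in> carrier_mat 2 2" "B \<in> carrier_mat 2 2" "C \<in> carrier_mat 2 2"
  shows "mat_trace (mat_list_prod 2 [A, B, C]) =
    (\<Sum>p<2. \<Sum>s<2. (\<Sum>q<2. A $$ (p,q) * B $$ (q,s)) * C $$ (s,p))"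
proof -
  have "A * (B * C) = A * B * C"
    using assms by simp
  then have "mat_list_prod 2 [A, B, C] = A * B * C"
    using assms by (simp add: mat_list_prod_def)
  then show ?thesis
    using assms by (simp add: mat_trace_def scalar_prod_def lessThan_atLeast0 del: assoc_mult_mat)
qed

text \<open>One family of matrices is repeated at all three positions. The inclusion carries
  non-membership of the limit over to \<open>IMPS\<close>, as non-closedness requires.\<close>

lemma IMPS_subset_MPS:
  "(IMPS 2 4 3 :: (nat list \<Rightarrow> 'a::comm_ring_1) set) \<subseteq> MPS [2,2,2] [4,4,4] 3"
proof
  fix T :: "nat list \<Rightarrow> 'a" assume "T \<in> IMPS 2 4 3"
  moreover have r: "replicate 3 4 = [4,4,4::nat]"
    by (simp add: numeral_3_eq_3)
  ultimately obtain M :: "nat \<Rightarrow> 'a mat" where T: "T \<in> tensor_space [4,4,4]"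
    and M: "\<forall>i<4. M i \<in> carrier_mat 2 2"
    and tr: "\<forall>is\<in>multi_indices [4,4,4]. T is = mat_trace (mat_list_prod 2 (map M is))"
    unfolding IMPS_def by auto
  have u: "[0..<3] = [0,1,2::nat]"
    by (simp add: upt_rec)
  have "\<forall>j<3. \<forall>i<[4,4,4::nat] ! j.
      M i \<in> carrier_mat ([2,2,2] ! j) ([2,2,2] ! (Suc j mod 3))"
  proof (intro allI impI)
    fix j i :: nat assume "j < 3" "i < [4,4,4] ! j"
    moreover from \<open>j < 3\<close> have "j = 0 \<or> j = 1 \<or> j = 2"
      by linarith
    ultimately show "M i \<in> carrier_mat ([2,2,2] ! j) ([2,2,2] ! (Suc j mod 3))"
      using M by (elim disjE) simp_all
  qed
  moreover have "\<forall>is\<in>multi_indices [4,4,4]. T is =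
      mat_trace (mat_list_prod ([2,2,2] ! 0) (map (\<lambda>j. M (is ! j)) [0..<3]))"
    using tr by (auto simp: multi_indices_444 u)
  ultimately show "T \<in> MPS [2,2,2] [4,4,4] 3"
    unfolding MPS_def using T by (auto intro!: exI[of _ "\<lambda>i j. M i"])
qed

lemma tensor_curve_in_IMPS:
  assumes "t \<noteq> 0"
  shows "(tensor_curve t :: nat list \<Rightarrow> 'a::real_normed_field) \<in> IMPS 2 4 3"
proof -
  define w :: "nat \<Rightarrow> 'a" where
    "w = (\<lambda>i. if i = 1 then inverse (of_real t) else if i = 2 then 1 else of_real t)"
  define M :: "nat \<Rightarrow> 'a mat" where
    "M = (\<lambda>i. mat 2 2 (\<lambda>(p, q). if i = 2 * p + q then w i else 0))"
  have M: "M i \<in> carrier_mat 2 2" for i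
    by (simp add: M_def)
  have t: "(of_real t :: 'a) \<noteq> 0"
    using assms by simp
  have tr: "tensor_curve t [i,j,k] = mat_trace (mat_list_prod 2 (map M [i,j,k]))"
    if "i < 4" "j < 4" "k < 4" for i j k
  proof -
    have e: "tensor_curve t [i,j,k] = (of_bool ([i,j,k] \<in> limit_support) +
        of_real t ^ 3 * of_bool ([i,j,k] \<in> {[0,0,0], [3,3,3]}) :: 'a)"
      using that by (simp add: tensor_curve_def multi_indices_444)
    have c: "n = 0 \<or> n = 1 \<or> n = 2 \<or> n = 3" if "n < 4" for n :: nat
      using that by linarith
    \<comment> \<open>All 64 triples are checked; \<open>t\<close> being nonzero cancels the weights
      on the triples of \<open>limit_support\<close>.\<close>
    show ?thesis
      unfolding e list.map mat_trace_prod3[OF M M M]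
      using c[OF that(1)] c[OF that(2)] c[OF that(3)] t
      by (elim disjE; hypsubst)
        (simp_all add: sum_lessThan_2 M_def w_def limit_support_def power3_eq_cube)
  qed
  have r: "replicate 3 4 = [4,4,4::nat]"
    by (simp add: numeral_3_eq_3)
  have "tensor_curve t \<in> (tensor_space [4,4,4] :: (nat list \<Rightarrow> 'a) set)"
    unfolding tensor_curve_def tensor_space_def by auto
  then show ?thesis
    unfolding IMPS_def r using M tr by (auto simp: multi_indices_444 intro!: exI[of _ M])
qed

section \<open>Linear dependence in the space of 2 x 2 matrices\<close>

text \<open>The functional sending Y to tr(N Y) is nonzero, so its kernel has dimension 3 and cannot
  hold four independent matrices.\<close>

lemma annihilated_matrices_dependent:
  fixes B :: "nat \<Rightarrow> nat \<Rightarrow> nat \<Rightarrow> 'a::field"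
  assumes N: "p0 < 2" "q0 < 2" "N p0 q0 \<noteq> 0"
    and ann: "\<And>j. j < 4 \<Longrightarrow> (\<Sum>p<2. \<Sum>q<2. N p q * B j q p) = 0"
  obtains w where "\<exists>j<4. w j \<noteq> 0" "\<And>p q. p < 2 \<Longrightarrow> q < 2 \<Longrightarrow> (\<Sum>j<4. w j * B j p q) = 0"
proof -
  \<comment> \<open>Row \<open>j\<close> lists \<open>B j\<close> column by column while
    \<open>v\<close> lists \<open>N\<close> row by row, so the entries of
    \<open>X *\<^sub>v v\<close> are the traces of \<open>N\<close> times
    \<open>B j\<close>.\<close>
  define X where "X = mat 4 4 (\<lambda>(j, m). B j (m mod 2) (m div 2))"
  have X: "X \<in> carrier_mat 4 4"
    by (simp add: X_def)
  define v where "v = vec 4 (\<lambda>m. N (m div 2) (m mod 2))"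
  have "v \<noteq> 0\<^sub>v 4"
  proof
    assume "v = 0\<^sub>v 4"
    moreover have "2 * p0 + q0 < 4"
      using N by simp
    ultimately have "v $ (2 * p0 + q0) = 0"
      by simp
    with N \<open>2 * p0 + q0 < 4\<close> show False
      by (simp add: v_def)
  qed
  moreover have "X *\<^sub>v v = 0\<^sub>v 4"
  proof
    fix j assume "j < dim_vec (0\<^sub>v 4 :: 'a vec)"
    with ann[of j] show "(X *\<^sub>v v) $ j = 0\<^sub>v 4 $ j"
      by (simp add: X_def v_def scalar_prod_def atLeast0LessThan sum_lessThan_2 sum_lessThan_4 algebra_simps)
  qed (simp add: X_def)
  moreover have "v \<in> carrier_vec 4"
    by (simp add: v_def)
  ultimately have "det X = 0"
    using det_0_iff_vec_prod_zero[OF X] by blast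
  \<comment> \<open>A kernel vector of the transpose is a linear relation between the rows of
    \<open>X\<close>, that is, between the \<open>B j\<close>.\<close>
  then have "det (transpose_mat X) = 0"
    using det_transpose[OF X] by simp
  then obtain w where w: "w \<in> carrier_vec 4" "w \<noteq> 0\<^sub>v 4" "transpose_mat X *\<^sub>v w = 0\<^sub>v 4"
    using det_0_iff_vec_prod_zero[of "transpose_mat X" 4] X by auto
  show thesis
  proof (rule that[of "\<lambda>j. w $ j"])
    show "\<exists>j<4. w $ j \<noteq> 0"
      using w(1,2) by (auto simp: vec_eq_iff)
    fix p q :: nat assume pq: "p < 2" "q < 2"
    then have l: "2 * q + p < 4"
      by simp
    have "(transpose_mat X *\<^sub>v w) $ (2 * q + p) = (\<Sum>j<4. B j p q * w $ j)"
      using l pq w(1) by (simp add: X_def scalar_prod_def lessThan_atLeast0)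
    with w(3) l show "(\<Sum>j<4. w $ j * B j p q) = 0"
      by (simp add: mult.commute)
  qed
qed

text \<open>The rank argument is run by hand: as the \<open>C k\<close> span, \<open>A 0\<close>
  times \<open>B j\<close> vanishes for \<open>j \<noteq> 1\<close>; a nonzero row of
  \<open>A 0\<close> then gives two independent functionals vanishing on three of the four
  independent \<open>B j\<close>.\<close>

lemma limit_tensor_not_in_MPS:
  "(limit_tensor :: nat list \<Rightarrow> 'a::real_normed_field) \<notin> MPS [2,2,2] [4,4,4] 3"
proof
  assume "(limit_tensor :: nat list \<Rightarrow> 'a) \<in> MPS [2,2,2] [4,4,4] 3"
  then obtain M :: "nat \<Rightarrow> nat \<Rightarrow> 'a mat" where
    M: "\<forall>j<3. \<forall>i<[4,4,4::nat] ! j. M i j \<in> carrier_mat ([2,2,2] ! j) ([2,2,2] ! (Suc j mod 3))"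
    and tr: "\<forall>is\<in>multi_indices [4,4,4]. limit_tensor is =
      mat_trace (mat_list_prod ([2,2,2] ! 0) (map (\<lambda>j. M (is ! j) j) [0..<3]))"
    unfolding MPS_def by blast
  have M': "M i 0 \<in> carrier_mat 2 2 \<and> M i 1 \<in> carrier_mat 2 2 \<and> M i 2 \<in> carrier_mat 2 2"
    if "i < 4" for i
    using M[rule_format, of 0 i] M[rule_format, of 1 i] M[rule_format, of 2 i] that by simp
  define A where "A = (\<lambda>i p q. M i 0 $$ (p, q))"
  define B where "B = (\<lambda>i p q. M i 1 $$ (p, q))"
  define C where "C = (\<lambda>i p q. M i 2 $$ (p, q))"
  have L: "(\<Sum>p<2. \<Sum>s<2. (\<Sum>q<2. A i p q * B j q s) * C k s p) =
      of_bool ([i,j,k] \<in> limit_support)"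
    if "i < 4" "j < 4" "k < 4" for i j k
  proof -
    have u: "[0..<3] = [0,1,2::nat]"
      by (simp add: upt_rec)
    have m: "[i,j,k] \<in> multi_indices [4,4,4]"
      using that by (simp add: multi_indices_444)
    have "of_bool ([i,j,k] \<in> limit_support) = (limit_tensor [i,j,k] :: 'a)"
      using m by (simp add: limit_tensor_def)
    also have "\<dots> = mat_trace (mat_list_prod 2 [M i 0, M j 1, M k 2])"
      using tr[rule_format, OF m] by (simp add: u)
    also have "\<dots> = (\<Sum>p<2. \<Sum>s<2. (\<Sum>q<2. A i p q * B j q s) * C k s p)"
      using M' that by (simp add: A_def B_def C_def mat_trace_prod3 del: One_nat_def)
    finally show ?thesis ..
  qed
  \<comment> \<open>A relation \<open>w\<close> between the \<open>C k\<close> would pass to the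
    slices of the limit with fixed third index, which are independent.\<close>
  have C_span: False
    if N: "p0 < 2" "q0 < 2" "N p0 q0 \<noteq> 0"
      and ann: "\<And>k. k < 4 \<Longrightarrow> (\<Sum>p<2. \<Sum>q<2. N p q * C k q p) = 0" for N p0 q0
  proof -
    obtain w where w: "\<exists>k<4. w k \<noteq> 0"
      "\<And>p q. p < 2 \<Longrightarrow> q < 2 \<Longrightarrow> (\<Sum>k<4. w k * C k p q) = 0"
      using annihilated_matrices_dependent[where N = N and B = C, OF N ann] by blast
    have z: "(\<Sum>k<4. w k * of_bool ([i,j,k] \<in> limit_support)) = 0" if "i < 4" "j < 4" for i j
    proof -
      have "(\<Sum>k<4. w k * of_bool ([i,j,k] \<in> limit_support)) =
          (\<Sum>k<4. w k * (\<Sum>p<2. \<Sum>s<2. (\<Sum>q<2. A i p q * B j q s) * C k s p))"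
        using L that by simp
      also have "\<dots> = (\<Sum>p<2. \<Sum>s<2. (\<Sum>q<2. A i p q * B j q s) * (\<Sum>k<4. w k * C k s p))"
        by (simp add: sum_lessThan_2 sum_lessThan_4 algebra_simps)
      also have "\<dots> = 0"
        using w(2) by simp
      finally show ?thesis .
    qed
    \<comment> \<open>Each pair of first indices has just one completion in
      \<open>limit_support\<close>, by 0, 1, 2, 3 in turn, so every \<open>w k\<close>
      vanishes.\<close>
    from z[of 1 2] z[of 2 0] z[of 0 1] z[of 2 1] w(1) show False
      by (auto simp: limit_support_def sum_lessThan_4 eval_nat_numeral less_Suc_eq)
  qed
  have B_span: False
    if N: "p0 < 2" "q0 < 2" "N p0 q0 \<noteq> 0"
      and ann: "\<And>j. j < 4 \<Longrightarrow> (\<Sum>p<2. \<Sum>q<2. N p q * B j q p) = 0" for N p0 q0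
  proof -
    obtain w where w: "\<exists>j<4. w j \<noteq> 0"
      "\<And>p q. p < 2 \<Longrightarrow> q < 2 \<Longrightarrow> (\<Sum>j<4. w j * B j p q) = 0"
      using annihilated_matrices_dependent[where N = N and B = B, OF N ann] by blast
    have z: "(\<Sum>j<4. w j * of_bool ([i,j,k] \<in> limit_support)) = 0" if "i < 4" "k < 4" for i k
    proof -
      have "(\<Sum>j<4. w j * of_bool ([i,j,k] \<in> limit_support)) =
          (\<Sum>j<4. w j * (\<Sum>p<2. \<Sum>s<2. (\<Sum>q<2. A i p q * B j q s) * C k s p))"
        using L that by simp
      also have "\<dots> = (\<Sum>p<2. \<Sum>s<2. (\<Sum>q<2. A i p q * (\<Sum>j<4. w j * B j q s)) * C k s p)"
        by (simp add: sum_lessThan_2 sum_lessThan_4 algebra_simps)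
      also have "\<dots> = 0"
        using w(2) by simp
      finally show ?thesis .
    qed
    \<comment> \<open>Here the first and third indices force the second to be 0, 1, 2, 3 in
      turn.\<close>
    from z[of 2 1] z[of 0 2] z[of 1 0] z[of 1 2] w(1) show False
      by (auto simp: limit_support_def sum_lessThan_4 eval_nat_numeral less_Suc_eq)
  qed
  \<comment> \<open>Only \<open>[0,1,2]\<close> in the support begins with 0, so for
    \<open>j \<noteq> 1\<close> the product of \<open>A 0\<close> and \<open>B j\<close> annihilates
    every \<open>C k\<close>.\<close>
  have AB: "(\<Sum>q<2. A 0 p q * B j q s) = 0" if "j < 4" "j \<noteq> 1" "p < 2" "s < 2" for j p s
  proof (rule ccontr)
    assume "(\<Sum>q<2. A 0 p q * B j q s) \<noteq> 0"
    moreover have "(\<Sum>p<2. \<Sum>s<2. (\<Sum>q<2. A 0 p q * B j q s) * C k s p) = 0" if "k < 4" for k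
      using L[of 0 j k] that \<open>j < 4\<close> \<open>j \<noteq> 1\<close> by (simp add: limit_support_def)
    ultimately show False
      using C_span[of p s "\<lambda>p s. \<Sum>q<2. A 0 p q * B j q s"] that by blast
  qed
  obtain r c where rc: "r < 2" "c < 2" "A 0 r c \<noteq> 0"
  proof -
    have "\<exists>r<2. \<exists>c<2. A 0 r c \<noteq> 0"
      using L[of 0 1 2] by (rule_tac ccontr) (auto simp: limit_support_def)
    then show ?thesis
      using that by blast
  qed
  \<comment> \<open>The functionals \<open>f 0\<close> and \<open>f 1\<close> both vanish on \<open>B 0\<close>, \<open>B 2\<close>, \<open>B 3\<close>, so a nontrivial
    combination of them vanishes on \<open>B 1\<close> as well.\<close>
  define f where "f = (\<lambda>s. \<Sum>q<2. A 0 r q * B 1 q s)"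
  obtain x :: "nat \<Rightarrow> 'a" where x: "x 0 \<noteq> 0 \<or> x 1 \<noteq> 0" "x 0 * f 0 + x 1 * f 1 = 0"
  proof (cases "f 0 = 0 \<and> f 1 = 0")
    case True
    then show ?thesis
      using that[of "\<lambda>_. 1"] by simp
  next
    case False
    then show ?thesis
      using that[of "\<lambda>s. if s = 0 then f 1 else - f 0"] by (auto simp: mult.commute)
  qed
  \<comment> \<open>The rank-one matrix with entries \<open>x p * A 0 r q\<close> represents the
    combined functional; it is nonzero in column \<open>c\<close>.\<close>
  have "(\<Sum>p<2. \<Sum>q<2. x p * A 0 r q * B j q p) = 0" if "j < 4" for j
  proof -
    have "(\<Sum>p<2. \<Sum>q<2. x p * A 0 r q * B j q p) = (\<Sum>p<2. x p * (\<Sum>q<2. A 0 r q * B j q p))"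
      by (simp add: sum_distrib_left mult.assoc)
    also have "\<dots> = 0"
    proof (cases "j = 1")
      case True
      then show ?thesis
        using x(2) by (simp add: f_def numeral_2_eq_2 lessThan_Suc add.commute)
    next
      case False
      then show ?thesis
        using AB[of j r] rc that by simp
    qed
    finally show ?thesis .
  qed
  moreover obtain p0 where "p0 < 2" "x p0 \<noteq> 0"
    using x(1) that[of 0] that[of 1] by auto
  ultimately show False
    using B_span[of p0 c "\<lambda>p q. x p * A 0 r q"] rc by simp
qed

section \<open>Convergence of the curve and failure of closedness\<close>

lemma continuous_tensor_curve_coordinate:
  "continuous_on UNIV (\<lambda>t. tensor_curve t is :: 'a::real_normed_field)"
  if "is \<in> multi_indices [4,4,4]"
  unfolding tensor_curve_def restrict_apply'[OF that] by (intro continuous_intros)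

text \<open>Working over any real normed field treats the real and the complex case at once.\<close>

lemma IMPS_limit_not_in_MPS:
  "\<not> closedin (tensor_topology [4, 4, 4]) (IMPS 2 4 3 :: (nat list \<Rightarrow> 'a::real_normed_field) set) \<and>
     (\<exists>(c :: real \<Rightarrow> nat list \<Rightarrow> 'a) L.
        continuous_map (top_of_set {0<..1}) (tensor_topology [4, 4, 4]) c \<and>
        (\<forall>t\<in>{0<..1}. c t \<in> IMPS 2 4 3) \<and>
        limitin (tensor_topology [4, 4, 4]) c L (at 0 within {0<..1}) \<and>
        L \<notin> MPS [2, 2, 2] [4, 4, 4] 3)"
proof -
  have ext: "(tensor_curve t :: nat list \<Rightarrow> 'a) \<in> extensional (multi_indices [4,4,4])" for t
    by (simp add: tensor_curve_def)
  have cont: "continuous_map (top_of_set {0<..1}) (tensor_topology [4,4,4])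
      (tensor_curve :: real \<Rightarrow> nat list \<Rightarrow> 'a)"
    unfolding tensor_topology_def continuous_map_componentwise
    using ext continuous_on_subset[OF continuous_tensor_curve_coordinate] by auto
  have mem: "\<forall>t\<in>{0<..1}. (tensor_curve t :: nat list \<Rightarrow> 'a) \<in> IMPS 2 4 3"
    by (auto intro!: tensor_curve_in_IMPS)
  have lim: "limitin (tensor_topology [4,4,4]) tensor_curve
      (limit_tensor :: nat list \<Rightarrow> 'a) (at 0 within {0<..1})"
    unfolding tensor_topology_def limitin_componentwise tensor_curve_0[symmetric]
  proof (intro conjI ballI)
    fix "is" assume "is \<in> multi_indices [4,4,4]"
    then have "isCont (\<lambda>t. tensor_curve t is :: 'a) 0"
      using continuous_tensor_curve_coordinate[where 'a = 'a]
      by (simp add: continuous_on_eq_continuous_at)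
    then have "((\<lambda>t. tensor_curve t is :: 'a) \<longlongrightarrow> tensor_curve 0 is) (at 0 within {0<..1})"
      unfolding isCont_def by (rule tendsto_within_subset) auto
    then show "limitin euclidean (\<lambda>t. tensor_curve t is :: 'a) (tensor_curve 0 is)
        (at 0 within {0<..1})"
      by simp
  qed (use ext in \<open>auto simp: PiE_def\<close>)
  have ev: "\<forall>\<^sub>F t in at 0 within {0<..1}. (tensor_curve t :: nat list \<Rightarrow> 'a) \<in> IMPS 2 4 3"
    using mem by (simp add: eventually_at_filter)
  \<comment> \<open>The point 0 is a limit point of the interval, so contradictory eventual
    statements do clash.\<close>
  have "at (0::real) within {0<..1} = at_right 0"
    by (rule at_within_nhd[of _ "{-1<..<1}"]) auto
  then have nontriv: "at (0::real) within {0<..1} \<noteq> bot"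
    by simp
  have not_IMPS: "limit_tensor \<notin> (IMPS 2 4 3 :: (nat list \<Rightarrow> 'a) set)"
    using IMPS_subset_MPS limit_tensor_not_in_MPS by blast
  have "\<not> closedin (tensor_topology [4,4,4]) (IMPS 2 4 3 :: (nat list \<Rightarrow> 'a) set)"
  proof
    assume "closedin (tensor_topology [4,4,4]) (IMPS 2 4 3 :: (nat list \<Rightarrow> 'a) set)"
    \<comment> \<open>The complement of a closed \<open>IMPS 2 4 3\<close> would be an open
      neighbourhood of the limit, which the curve would have to enter.\<close>
    with lim not_IMPS have "\<forall>\<^sub>F t in at 0 within {0<..1}.
        (tensor_curve t :: nat list \<Rightarrow> 'a) \<in> tensor_space [4,4,4] - IMPS 2 4 3"
      by (auto simp: limitin_def closedin_def)
    with ev have "\<forall>\<^sub>F t in at (0::real) within {0<..1}. False"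
      by eventually_elim auto
    with nontriv show False
      by (simp add: trivial_limit_def)
  qed
  with cont mem lim limit_tensor_not_in_MPS show ?thesis
    by blast
qed

theorem theorem4p5:
  shows "(\<not> closedin (tensor_topology [4, 4, 4]) (IMPS 2 4 3 :: (nat list \<Rightarrow> real) set) \<and>
     (\<exists>(c :: real \<Rightarrow> nat list \<Rightarrow> real) L.
        continuous_map (top_of_set {0<..1}) (tensor_topology [4, 4, 4]) c \<and>
        (\<forall>t\<in>{0<..1}. c t \<in> IMPS 2 4 3) \<and>
        limitin (tensor_topology [4, 4, 4]) c L (at 0 within {0<..1}) \<and>
        L \<notin> MPS [2, 2, 2] [4, 4, 4] 3)) \<and>
   (\<not> closedin (tensor_topology [4, 4, 4]) (IMPS 2 4 3 :: (nat list \<Rightarrow> complex) set) \<and>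
     (\<exists>(c :: real \<Rightarrow> nat list \<Rightarrow> complex) L.
        continuous_map (top_of_set {0<..1}) (tensor_topology [4, 4, 4]) c \<and>
        (\<forall>t\<in>{0<..1}. c t \<in> IMPS 2 4 3) \<and>
        limitin (tensor_topology [4, 4, 4]) c L (at 0 within {0<..1}) \<and>
        L \<notin> MPS [2, 2, 2] [4, 4, 4] 3))"
  by (intro conjI IMPS_limit_not_in_MPS[THEN conjunct1] IMPS_limit_not_in_MPS[THEN conjunct2])

end
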